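(* Let $n\ge 2$ and let $\Lambda$ be the preprojective algebra of type $A_{n-1}$. Let $T$ be a semistandard Young tableau with entries in $\{1,\dots,n\}$ and at most $n-1$ rows, and let $M$ be a $\Lambda$-module of type $T$. Let $1\le i<t\le n$ and let $A=\{t-i+1,t-i+2,\dots,t\}$. Then $$\dim\operatorname{Hom}_\Lambda(M,N(A))=\#\{\text{boxes } X \text{ of } T: r(X)\le i<c(X)\le t\},$$ where $r(X)$ is the row index of the box $X$, $c(X)$ is the entry in the box $X$, and $N(A)$ is the Maya module.
   Context: Fix a ground field. Let $I=\{1,\dots,n-1\}$. A (finite-dimensional) $\Lambda$-module is an $I$-graded finite-dimensional vector space $M=\bigoplus_{i\in I}M_i$ with linear maps $(i\to i+1):M_i\to M_{i+1}$ (for $1\le i\le n-2$) and $(i\to i-1):M_i\to M_{i-1}$ (for $2\le i\le n-1$) satisfying, for every $i\in I$, $$(i+1\to i)\circ(i\to i+1)=(i-1\to i)\circ(i\to i-1)\quad\text{on } M_i,$$ with the convention $M_0=M_n=0$, so that $(1\to 0)$ and $(n-1\to n)$ are zero. Homomorphisms are graded linear maps commuting with all these maps. Maya modules: let $A=\{a_1<\dots<a_i\}$ be a proper subset of $\{1,\dots,n\}$ of size $i$ with $A\ne\{1,\dots,i\}$. $N(A)$ has basis $\{w_{j,k}: 1\le k\le i,\ k\le j\le a_k-1\}$ with $w_{j,k}\in N(A)_j$, and $$(j\to j-1)(w_{j,k})=w_{j-1,k},\qquad (j\to j+1)(w_{j,k})=w_{j+1,k+1},$$ where $w_{j,k}$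 is interpreted as $0$ whenever $(j,k)$ is not in the index set of the basis. Semistandard: entries weakly increase along rows (left to right) and strictly increase down columns; rows are numbered $1,2,\dots$ from the top (so $c(X)\ge r(X)$ for every box $X$). A $\Lambda$-module $M$ is of type $T$ if there are vectors $w_j^X\in M_j$, for each box $X$ of $T$ and each $j$ with $r(X)\le j\le c(X)-1$, which together (over all boxes $X$) form a basis of $M$, and there are scalars $d_Y^X$ such that for every box $Y$ and every $j$ with $r(Y)\le j\le c(Y)-1$, $$(j\to j-1)(w_j^Y)=w_{j-1}^Y,\qquad (j\to j+1)(w_j^Y)=\sum_{X}d_Y^X\,w_{j+1}^X,$$ where the sum is over all boxes $X$ with $r(Y)<r(X)\le c(Y)<c(X)$, and $w_j^X$ is interpreted as $0$ if $j<r(X)$ or $j>c(X)-1$. *)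

theory Defs
  imports Complex_Main "HOL-Library.Function_Algebras"
begin

subsection \<open>Vector spaces\<close>

text \<open>Vector spaces over the ground field \<open>'k\<close> are subspaces of an ambient type \<open>'v\<close> whose scalar
  multiplication \<open>s\<close> satisfies \<^locale>\<open>vector_space\<close>.\<close>

definition linear_on ::
  "('k \<Rightarrow> 'v \<Rightarrow> 'v) \<Rightarrow> ('k \<Rightarrow> 'w \<Rightarrow> 'w) \<Rightarrow> 'v set \<Rightarrow> ('v::plus \<Rightarrow> 'w::plus) \<Rightarrow> bool" where
  "linear_on s s' U f \<longleftrightarrow>
     (\<forall>x\<in>U. \<forall>y\<in>U. f (x + y) = f x + f y) \<and> (\<forall>c. \<forall>x\<in>U. f (s c x) = s' c (f x))"

definition fun_scale :: "('k \<Rightarrow> 'w \<Rightarrow> 'w) \<Rightarrow> 'k \<Rightarrow> ('x \<Rightarrow> 'w) \<Rightarrow> 'x \<Rightarrow> 'w" where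
  "fun_scale s c f = (\<lambda>x. s c (f x))"

lemma vector_space_fun_scale:
  fixes s :: "'k::field \<Rightarrow> 'w::ab_group_add \<Rightarrow> 'w"
  assumes "vector_space s"
  shows "vector_space (fun_scale s :: 'k \<Rightarrow> ('x \<Rightarrow> 'w) \<Rightarrow> _)"
proof -
  interpret vector_space s by fact
  show ?thesis
    by unfold_locales (auto simp: fun_scale_def fun_eq_iff scale_right_distrib scale_left_distrib)
qed

lemma vector_space_times: "vector_space ((*) :: 'k::field \<Rightarrow> 'k \<Rightarrow> 'k)"
  by unfold_locales (auto simp: algebra_simps)

subsection \<open>Modules over the preprojective algebra of type \<open>A\<^bsub>n-1\<^esub>\<close>\<close>

text \<open>\<open>comp M i\<close> is the component \<open>M\<^sub>i\<close>; \<open>up M i\<close> and \<open>down M i\<close> are the maps \<open>(i \<rightarrow> i+1)\<close> and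
  \<open>(i \<rightarrow> i-1)\<close>, whose values outside \<open>M\<^sub>i\<close> carry no information.\<close>

record 'v graded_rep =
  comp :: "nat \<Rightarrow> 'v set"
  up :: "nat \<Rightarrow> 'v \<Rightarrow> 'v"
  down :: "nat \<Rightarrow> 'v \<Rightarrow> 'v"

definition total_space ::
  "('k::field \<Rightarrow> 'v::ab_group_add \<Rightarrow> 'v) \<Rightarrow> nat \<Rightarrow> 'v graded_rep \<Rightarrow> 'v set" where
  "total_space s n M = module.span s (\<Union>i\<in>{1..n-1}. comp M i)"

text \<open>The grading is an internal direct sum. Components outside \<open>{1..n-1}\<close> are zero, so the maps
  \<open>(1 \<rightarrow> 0)\<close> and \<open>(n-1 \<rightarrow> n)\<close> vanish. Since \<open>up M 0\<close> and \<open>down M n\<close> are unconstrained, composites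
  through \<open>M\<^sub>0\<close> and \<open>M\<^sub>n\<close> are replaced by 0 in the preprojective relation.\<close>

definition Lambda_module ::
  "('k::field \<Rightarrow> 'v::ab_group_add \<Rightarrow> 'v) \<Rightarrow> nat \<Rightarrow> 'v graded_rep \<Rightarrow> bool" where
  "Lambda_module s n M \<longleftrightarrow>
     vector_space s \<and>
     (\<forall>i. module.subspace s (comp M i)) \<and>
     (\<forall>i. i \<notin> {1..n-1} \<longrightarrow> comp M i = {0}) \<and>
     (\<forall>v. (\<forall>i\<in>{1..n-1}. v i \<in> comp M i) \<and> (\<Sum>i\<in>{1..n-1}. v i) = 0
            \<longrightarrow> (\<forall>i\<in>{1..n-1}. v i = 0)) \<and>
     (\<exists>B. finite B \<and> total_space s n M = module.span s B) \<and>
     (\<forall>i\<in>{1..n-1}.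
        linear_on s s (comp M i) (up M i) \<and> up M i ` comp M i \<subseteq> comp M (i + 1) \<and>
        linear_on s s (comp M i) (down M i) \<and> down M i ` comp M i \<subseteq> comp M (i - 1)) \<and>
     (\<forall>i\<in>{1..n-1}. \<forall>v\<in>comp M i.
        (if i + 1 \<le> n - 1 then down M (i + 1) (up M i v) else 0) =
        (if 1 \<le> i - 1 then up M (i - 1) (down M i v) else 0))"

text \<open>Homomorphisms are maps on the total space; they are set to zero outside it so that each
  homomorphism is represented by exactly one function.\<close>

definition Lambda_Hom ::
  "('k::field \<Rightarrow> 'v::ab_group_add \<Rightarrow> 'v) \<Rightarrow> ('k \<Rightarrow> 'w::ab_group_add \<Rightarrow> 'w) \<Rightarrow> nat \<Rightarrow>
   'v graded_rep \<Rightarrow> 'w graded_rep \<Rightarrow> ('v \<Rightarrow> 'w) set" where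
  "Lambda_Hom s s' n M N =
     {f. linear_on s s' (total_space s n M) f \<and>
         (\<forall>x. x \<notin> total_space s n M \<longrightarrow> f x = 0) \<and>
         (\<forall>i\<in>{1..n-1}. f ` comp M i \<subseteq> comp N i) \<and>
         (\<forall>i\<in>{1..n-1}. \<forall>v\<in>comp M i.
            f (up M i v) = up N i (f v) \<and> f (down M i v) = down N i (f v))}"

subsection \<open>Maya modules\<close>

definition maya_index :: "nat set \<Rightarrow> (nat \<times> nat) set" where
  "maya_index A = {(j, k). 1 \<le> k \<and> k \<le> card A \<and> k \<le> j \<and> j \<le> sorted_list_of_set A ! (k - 1) - 1}"

text \<open>\<open>N(A)\<close> lives in the functions \<open>nat \<times> nat \<Rightarrow> 'k\<close>, with scaling \<open>maya_scale\<close>; the basis vector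
  \<open>w\<^bsub>j,k\<^esub>\<close> is the indicator function of \<open>(j, k)\<close>. The coordinate of \<open>v\<close> at \<open>w\<^bsub>j,k\<^esub>\<close> is \<open>v (j, k)\<close>.\<close>

abbreviation maya_scale :: "'k::field \<Rightarrow> (nat \<times> nat \<Rightarrow> 'k) \<Rightarrow> nat \<times> nat \<Rightarrow> 'k" where
  "maya_scale \<equiv> fun_scale (*)"

definition maya_w :: "nat set \<Rightarrow> nat \<Rightarrow> nat \<Rightarrow> nat \<times> nat \<Rightarrow> 'k::field" where
  "maya_w A j k = (if (j, k) \<in> maya_index A then (\<lambda>p. if p = (j, k) then 1 else 0) else 0)"

definition maya_module :: "nat set \<Rightarrow> (nat \<times> nat \<Rightarrow> 'k::field) graded_rep" where
  "maya_module A =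
     \<lparr>comp = (\<lambda>j. module.span maya_scale {maya_w A j k | k. (j, k) \<in> maya_index A}),
      up = (\<lambda>j v. \<Sum>k | (j, k) \<in> maya_index A. maya_scale (v (j, k)) (maya_w A (j + 1) (k + 1))),
      down = (\<lambda>j v. \<Sum>k | (j, k) \<in> maya_index A. maya_scale (v (j, k)) (maya_w A (j - 1) k))\<rparr>"

lemma maya_module_maps:
  fixes A :: "nat set"
  assumes jk: "(j, k) \<in> maya_index A"
  shows "up (maya_module A) j (maya_w A j k :: _ \<Rightarrow> 'k::field) = maya_w A (j + 1) (k + 1)"
    and "down (maya_module A) j (maya_w A j k :: _ \<Rightarrow> 'k) = maya_w A (j - 1) k"
proof -
  have fin: "finite {k. (j, k) \<in> maya_index A}"
    by (rule finite_subset[of _ "{..card A}"]) (auto simp: maya_index_def)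
  have delta: "(\<Sum>k' | (j, k') \<in> maya_index A. maya_scale ((maya_w A j k :: _ \<Rightarrow> 'k) (j, k')) (g k')) = g k" for g
  proof -
    have "maya_scale ((maya_w A j k :: _ \<Rightarrow> 'k) (j, k')) (g k') = (if k' = k then g k' else 0)" for k'
      using jk by (auto simp: maya_w_def fun_scale_def fun_eq_iff)
    then show ?thesis using fin jk by simp
  qed
  show "up (maya_module A) j (maya_w A j k :: _ \<Rightarrow> 'k) = maya_w A (j + 1) (k + 1)"
    and "down (maya_module A) j (maya_w A j k :: _ \<Rightarrow> 'k) = maya_w A (j - 1) k"
    using delta by (simp_all add: maya_module_def)
qed

subsection \<open>Semistandard tableaux and modules of type \<open>T\<close>\<close>

text \<open>A tableau is the list of its rows from top to bottom; the box \<open>(p, q)\<close> is in row \<open>p\<close> and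
  column \<open>q\<close>, both counted from 1.\<close>

definition boxes :: "nat list list \<Rightarrow> (nat \<times> nat) set" where
  "boxes T = {(p, q). 1 \<le> p \<and> p \<le> length T \<and> 1 \<le> q \<and> q \<le> length (T ! (p - 1))}"

definition box_row :: "nat \<times> nat \<Rightarrow> nat" where
  "box_row X = fst X"

definition box_entry :: "nat list list \<Rightarrow> nat \<times> nat \<Rightarrow> nat" where
  "box_entry T X = T ! (fst X - 1) ! (snd X - 1)"

definition semistandard :: "nat list list \<Rightarrow> bool" where
  "semistandard T \<longleftrightarrow>
     [] \<notin> set T \<and>
     sorted_wrt (\<ge>) (map length T) \<and>
     (\<forall>p q q'. (p, q) \<in> boxes T \<and> (p, q') \<in> boxes T \<and> q \<le> q' \<longrightarrow>
        box_entry T (p, q) \<le> box_entry T (p, q')) \<and>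
     (\<forall>p p' q. (p, q) \<in> boxes T \<and> (p', q) \<in> boxes T \<and> p < p' \<longrightarrow>
        box_entry T (p, q) < box_entry T (p', q))"

definition type_index :: "nat list list \<Rightarrow> ((nat \<times> nat) \<times> nat) set" where
  "type_index T = {(X, j). X \<in> boxes T \<and> box_row X \<le> j \<and> j \<le> box_entry T X - 1}"

text \<open>Here \<open>w X j\<close> is \<open>w\<^sub>j\<^sup>X\<close> and \<open>d X Y\<close> is the scalar with upper index \<open>X\<close> and lower index \<open>Y\<close>.\<close>

definition of_type ::
  "('k::field \<Rightarrow> 'v::ab_group_add \<Rightarrow> 'v) \<Rightarrow> nat \<Rightarrow> nat list list \<Rightarrow> 'v graded_rep \<Rightarrow> bool" where
  "of_type s n T M \<longleftrightarrow>
     (\<exists>w d.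
        (\<forall>X j. (X, j) \<notin> type_index T \<longrightarrow> w X j = 0) \<and>
        (\<forall>(X, j)\<in>type_index T. w X j \<in> comp M j) \<and>
        inj_on (\<lambda>(X, j). w X j) (type_index T) \<and>
        \<not> module.dependent s ((\<lambda>(X, j). w X j) ` type_index T) \<and>
        module.span s ((\<lambda>(X, j). w X j) ` type_index T) = total_space s n M \<and>
        (\<forall>(Y, j)\<in>type_index T.
           down M j (w Y j) = w Y (j - 1) \<and>
           up M j (w Y j) =
             (\<Sum>X | X \<in> boxes T \<and> box_row Y < box_row X \<and> box_row X \<le> box_entry T Y
                    \<and> box_entry T Y < box_entry T X.
                s (d X Y) (w X (j + 1)))))"

end

theory Submission
  imports Defs
begin

text \<open>For \<open>A = {t-i+1..t}\<close> the module \<open>N(A)\<close> is the injective hull of the simple module at \<open>i\<close> over the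
  preprojective algebra of type \<open>A\<^bsub>t-1\<^esub>\<close>. Hence a homomorphism \<open>f\<close> from \<open>M\<close> is determined by the
  functional \<open>\<phi>\<close> on \<open>M\<^sub>i\<close> reading off the socle coordinate \<open>w\<^bsub>i,i\<^esub>\<close>, namely
  \<open>f(x)\<^bsub>j,k\<^esub> = \<phi>(down\<^bsup>j-k\<^esup> up\<^bsup>i-k\<^esup> x)\<close>, and the functionals that occur are those vanishing on the
  degree \<open>i\<close> part of the submodule generated by the \<open>M\<^sub>j\<close> with \<open>j \<ge> t\<close>. As every \<open>w\<^sub>j\<^sup>X\<close> is obtained from
  the one of degree \<open>c(X) - 1\<close> by maps \<open>down\<close>, that part is spanned by the \<open>w\<^sub>i\<^sup>X\<close> with \<open>c(X) > t\<close>.\<close>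

section \<open>Linear algebra: bases given as families, dimension via dual functionals, maps linear
  on a span\<close>

lemma exists_linear_on_basis:
  assumes "vector_space s" "vector_space s'"
    and inj: "inj_on g I" and indep: "\<not> module.dependent s (g ` I)"
  obtains L where "Vector_Spaces.linear s s' L" "\<And>p. p \<in> I \<Longrightarrow> L (g p) = h p"
proof -
  interpret vector_space_pair s s' using assms(1,2) by (rule vector_space_pair.intro)
  obtain L where L: "Vector_Spaces.linear s s' L" "\<forall>x\<in>g ` I. L x = h (inv_into I g x)"
    using linear_independent_extend[OF indep, of "\<lambda>x. h (inv_into I g x)"] by auto
  show thesis
    by (rule that[OF L(1)]) (use L(2) inj in auto)
qed

text \<open>Duality makes the \<open>F X\<close> independent, since applying \<open>ev X\<close> to
  a linear relation isolates its coefficient at \<open>X\<close>. They span because \<open>f\<close>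
  minus the combination with coefficients \<open>ev Y f\<close> is killed by every
  \<open>ev X\<close>, hence is zero.\<close>

lemma dim_eq_card_dual_family:
  fixes s :: "'k::field \<Rightarrow> 'v::ab_group_add \<Rightarrow> 'v" and ev :: "'x \<Rightarrow> 'v \<Rightarrow> 'k"
  assumes "vector_space s" and V: "module.subspace s V" and fin: "finite S"
    and F: "\<And>X. X \<in> S \<Longrightarrow> F X \<in> V"
    and ev: "\<And>X. Vector_Spaces.linear s (*) (ev X)"
    and dual: "\<And>X Y. X \<in> S \<Longrightarrow> Y \<in> S \<Longrightarrow> ev X (F Y) = (if X = Y then 1 else 0)"
    and zero: "\<And>f. f \<in> V \<Longrightarrow> (\<And>X. X \<in> S \<Longrightarrow> ev X f = 0) \<Longrightarrow> f = 0"
  shows "vector_space.dim s V = card S"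
proof -
  interpret vector_space s by fact
  have ev_zero: "ev X 0 = 0" and ev_diff: "ev X (a - b) = ev X a - ev X b" for X a b
  proof -
    interpret ev: Vector_Spaces.linear s "(*)" "ev X" by (rule ev)
    show "ev X 0 = 0" "ev X (a - b) = ev X a - ev X b" by (rule ev.zero, rule ev.diff)
  qed
  have ev_sum: "ev X (\<Sum>Y\<in>S. s (u Y) (F Y)) = u X" if "X \<in> S" for X u
  proof -
    interpret ev: Vector_Spaces.linear s "(*)" "ev X" by (rule ev)
    have "ev X (\<Sum>Y\<in>S. s (u Y) (F Y)) = (\<Sum>Y\<in>S. if X = Y then u Y else 0)"
      unfolding ev.sum ev.scale by (intro sum.cong) (auto simp: dual that)
    also have "\<dots> = u X" using that fin by simp
    finally show ?thesis .
  qed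
  have inj: "inj_on F S"
    by (rule inj_onI) (metis dual zero_neq_one)
  have indep: "independent (F ` S)"
  proof
    assume "dependent (F ` S)"
    then obtain u X where u: "X \<in> S" "u (F X) \<noteq> 0" "(\<Sum>v\<in>F ` S. s (u v) v) = 0"
      using fin by (auto simp: dependent_finite)
    have "(\<Sum>Y\<in>S. s (u (F Y)) (F Y)) = 0"
      using u(3) by (simp add: sum.reindex[OF inj] o_def)
    with ev_sum[OF u(1), of "\<lambda>Y. u (F Y)"] u(2) show False
      by (simp add: ev_zero)
  qed
  have "f \<in> span (F ` S)" if f: "f \<in> V" for f
  proof -
    let ?g = "\<Sum>Y\<in>S. s (ev Y f) (F Y)"
    have "?g \<in> V" using F by (intro subspace_sum V subspace_scale)
    then have "f - ?g \<in> V" using f V by (rule_tac subspace_diff)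
    moreover have "ev X (f - ?g) = 0" if "X \<in> S" for X
      using ev_sum[OF that, of "\<lambda>Y. ev Y f"] by (simp add: ev_diff)
    ultimately have "f = ?g" using zero[of "f - ?g"] by simp
    moreover have "?g \<in> span (F ` S)" by (intro span_sum span_scale span_base imageI)
    ultimately show ?thesis by simp
  qed
  then show ?thesis
    by (intro dim_unique[of "F ` S"]) (use F indep inj in \<open>auto simp: card_image\<close>)
qed

lemma linear_on_zero:
  assumes "vector_space s" "vector_space s'" and "linear_on s s' (module.span s B) f"
  shows "f 0 = 0"
proof -
  interpret V: vector_space s by fact
  interpret W: vector_space s' by fact
  have "f (s 0 0) = s' 0 (f 0)" using assms(3) V.span_zero unfolding linear_on_def by blast
  then show ?thesis by simp
qed

lemma linear_on_eq_on_span: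
  assumes "vector_space s" "vector_space s'"
    and f: "linear_on s s' (module.span s B) f" and g: "linear_on s s' (module.span s B) g"
    and eq: "\<And>x. x \<in> B \<Longrightarrow> f x = g x" and x: "x \<in> module.span s B"
  shows "f x = g x"
proof -
  interpret V: vector_space s by fact
  interpret W: vector_space s' by fact
  have "V.subspace {x \<in> V.span B. f x = g x}"
    using f g by (intro V.subspaceI)
      (auto simp: linear_on_def linear_on_zero[OF assms(1,2) f] linear_on_zero[OF assms(1,2) g] V.span_zero V.span_add V.span_scale)
  then have "V.span B \<subseteq> {x \<in> V.span B. f x = g x}"
    by (intro V.span_minimal) (auto simp: eq V.span_base)
  with x show ?thesis by auto
qed

lemma linear_imp_linear_on:
  assumes "Vector_Spaces.linear s s' f"
  shows "linear_on s s' U f"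
proof -
  interpret Vector_Spaces.linear s s' f by fact
  show ?thesis by (simp add: linear_on_def add scale)
qed

subsection \<open>Maya modules in coordinates\<close>

lemma finite_maya_column [simp]: "finite {k. (j, k) \<in> maya_index A}"
  by (rule finite_subset[of _ "{..card A}"]) (auto simp: maya_index_def)

lemma sum_fun_apply: "(\<Sum>x\<in>S. f x) p = (\<Sum>x\<in>S. f x p)"
  by (induction S rule: infinite_finite_induct) auto

text \<open>Describing the graded pieces by supports lets every later argument about
  \<open>maya_module\<close> be carried out one coordinate at a time.\<close>

lemma maya_comp_iff:
  fixes v :: "nat \<times> nat \<Rightarrow> 'k::field"
  shows "v \<in> comp (maya_module A) j \<longleftrightarrow> (\<forall>p. v p \<noteq> 0 \<longrightarrow> p \<in> maya_index A \<and> fst p = j)"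
    (is "_ \<longleftrightarrow> ?R v")
proof -
  interpret vector_space "maya_scale :: 'k \<Rightarrow> _"
    by (intro vector_space_fun_scale vector_space_times)
  let ?B = "{maya_w A j k | k. (j, k) \<in> maya_index A} :: (nat \<times> nat \<Rightarrow> 'k) set"
  have "span ?B \<subseteq> {v. ?R v}"
    by (intro span_minimal subspaceI)
      (auto simp: maya_w_def fun_scale_def split: if_splits, (metis add_0)+)
  moreover have "v \<in> span ?B" if "?R v"
  proof -
    have "v = (\<Sum>k | (j, k) \<in> maya_index A. maya_scale (v (j, k)) (maya_w A j k))"
    proof
      fix p :: "nat \<times> nat"
      have "(\<Sum>k | (j, k) \<in> maya_index A. maya_scale (v (j, k)) (maya_w A j k)) p
          = (\<Sum>k | (j, k) \<in> maya_index A. if p = (j, k) then v p else 0)"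
        by (auto simp: sum_fun_apply maya_w_def fun_scale_def intro!: sum.cong)
      \<comment> \<open>Splitting the equation of pairs leaves a delta in \<open>k\<close> alone,
        the form in which the simplifier evaluates the sum.\<close>
      also have "\<dots> = (\<Sum>k | (j, k) \<in> maya_index A. if snd p = k then (if fst p = j then v p else 0) else 0)"
        by (intro sum.cong) (auto simp: prod_eq_iff)
      also have "\<dots> = v p" using that by (cases p) auto
      finally show "v p = (\<Sum>k | (j, k) \<in> maya_index A. maya_scale (v (j, k)) (maya_w A j k)) p" by simp
    qed
    also have "\<dots> \<in> span ?B" by (intro span_sum span_scale span_base) auto
    finally show ?thesis .
  qed
  ultimately show ?thesis by (auto simp: maya_module_def)
qed

lemma maya_up_apply:
  "up (maya_module A) j v (a, b) =
     (if a = j + 1 \<and> 1 \<le> b \<and> (j, b - 1) \<in> maya_index A \<and> (a, b) \<in> maya_index A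
      then v (j, b - 1) else 0)"
proof -
  \<comment> \<open>The guard \<open>1 <= b\<close> is there because truncated subtraction would let
    \<open>b = 0\<close> match \<open>k = 0\<close>.\<close>
  have "maya_scale (v (j, k)) (maya_w A (j + 1) (k + 1)) (a, b)
      = (if b - 1 = k then (if a = j + 1 \<and> 1 \<le> b \<and> (a, b) \<in> maya_index A then v (j, b - 1) else 0) else 0)" for k
    by (auto simp: maya_w_def fun_scale_def)
  then show ?thesis by (auto simp: maya_module_def sum_fun_apply)
qed

lemma maya_down_apply:
  "down (maya_module A) j v (a, b) =
     (if a = j - 1 \<and> (j, b) \<in> maya_index A \<and> (a, b) \<in> maya_index A then v (j, b) else 0)"
proof -
  have "maya_scale (v (j, k)) (maya_w A (j - 1) (k)) (a, b)
      = (if b = k then (if a = j - 1 \<and> (a, b) \<in> maya_index A then v (j, b) else 0) else 0)" for k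
    by (auto simp: maya_w_def fun_scale_def)
  then show ?thesis by (auto simp: maya_module_def sum_fun_apply)
qed

text \<open>The k-th smallest element of the interval is t-i+k, so the bound on j is t-i+k-1; moving
  i to the other side avoids subtraction of naturals.\<close>

lemma maya_index_interval:
  assumes "i < t"
  shows "(j, k) \<in> maya_index {t - i + 1..t} \<longleftrightarrow> 1 \<le> k \<and> k \<le> i \<and> k \<le> j \<and> j + i < t + k"
proof -
  have "sorted_list_of_set {t - i + 1..t} = [t - i + 1..<Suc t]"
    by (simp only: atLeastLessThanSuc_atLeastAtMost[symmetric] sorted_list_of_set_range)
  then have "maya_index {t - i + 1..t}
      = {(j, k). 1 \<le> k \<and> k \<le> i \<and> k \<le> j \<and> j \<le> [t - i + 1..<Suc t] ! (k - 1) - 1}"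
    using assms by (simp add: maya_index_def)
  moreover have "[t - i + 1..<Suc t] ! (k - 1) = t - i + k" if "1 \<le> k" "k \<le> i"
    using that assms by (subst nth_upt) auto
  ultimately show ?thesis using assms by auto
qed

lemma subspace_Hom_maya:
  fixes s :: "'k::field \<Rightarrow> 'v::ab_group_add \<Rightarrow> 'v" and A :: "nat set"
  assumes "vector_space s"
  shows "module.subspace (fun_scale maya_scale)
    (Lambda_Hom s maya_scale n M (maya_module A :: (nat \<times> nat \<Rightarrow> 'k) graded_rep))"
proof -
  interpret vector_space "fun_scale maya_scale :: 'k \<Rightarrow> ('v \<Rightarrow> nat \<times> nat \<Rightarrow> 'k) \<Rightarrow> _"
    by (intro vector_space_fun_scale vector_space_times)
  let ?N = "maya_module A :: (nat \<times> nat \<Rightarrow> 'k) graded_rep"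
  have up: "up ?N j 0 = 0" "up ?N j (v + w) = up ?N j v + up ?N j w"
    "up ?N j (maya_scale c v) = maya_scale c (up ?N j v)" for j v w c
    by (auto simp: fun_eq_iff maya_up_apply fun_scale_def)
  have down: "down ?N j 0 = 0" "down ?N j (v + w) = down ?N j v + down ?N j w"
    "down ?N j (maya_scale c v) = maya_scale c (down ?N j v)" for j v w c
    by (auto simp: fun_eq_iff maya_down_apply fun_scale_def)
  have comp: "0 \<in> comp ?N j" "v \<in> comp ?N j \<Longrightarrow> w \<in> comp ?N j \<Longrightarrow> v + w \<in> comp ?N j"
    "v \<in> comp ?N j \<Longrightarrow> maya_scale c v \<in> comp ?N j" for j v w c
  proof -
    interpret maya: vector_space "maya_scale :: 'k \<Rightarrow> _"
      by (intro vector_space_fun_scale vector_space_times)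
    show "0 \<in> comp ?N j" "v \<in> comp ?N j \<Longrightarrow> w \<in> comp ?N j \<Longrightarrow> v + w \<in> comp ?N j"
      "v \<in> comp ?N j \<Longrightarrow> maya_scale c v \<in> comp ?N j"
      by (simp_all add: maya_module_def maya.span_zero maya.span_add maya.span_scale)
  qed
  have scale: "maya_scale c (0 :: _ \<Rightarrow> 'k) = 0" "maya_scale c (v + w) = maya_scale c v + maya_scale c w"
    "maya_scale c (maya_scale c' v) = maya_scale c' (maya_scale c v)" for c c' :: 'k and v w
    by (auto simp: fun_scale_def fun_eq_iff algebra_simps)
  show ?thesis
    by (rule subspaceI)
      (auto simp: Lambda_Hom_def linear_on_def fun_scale_def[of maya_scale] up down comp scale image_subset_iff)
qed

subsection \<open>Modules with a tableau basis\<close>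

lemma finite_boxes [simp]: "finite (boxes T)"
proof (rule finite_subset)
  show "boxes T \<subseteq> (\<Union>p\<in>{1..length T}. {p} \<times> {1..length (T ! (p - 1))})"
    by (auto simp: boxes_def)
qed auto

locale tableau_module = vector_space s
  for s :: "'k::field \<Rightarrow> 'v::ab_group_add \<Rightarrow> 'v" +
  fixes n :: nat and T :: "nat list list" and M :: "'v graded_rep" and w :: "nat \<times> nat \<Rightarrow> nat \<Rightarrow> 'v"
  assumes Lambda: "Lambda_module s n M"
    and entry_le: "X \<in> boxes T \<Longrightarrow> box_entry T X \<le> n"
    and w_zero: "(X, j) \<notin> type_index T \<Longrightarrow> w X j = 0"
    and w_comp: "(X, j) \<in> type_index T \<Longrightarrow> w X j \<in> comp M j"
    and w_inj: "inj_on (\<lambda>(X, j). w X j) (type_index T)"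
    and w_indep: "independent ((\<lambda>(X, j). w X j) ` type_index T)"
    and w_span: "span ((\<lambda>(X, j). w X j) ` type_index T) = total_space s n M"
    and down_w: "(X, j) \<in> type_index T \<Longrightarrow> down M j (w X j) = w X (j - 1)"
begin

abbreviation w_deg :: "nat \<Rightarrow> 'v set" where
  "w_deg j \<equiv> {w Y j | Y. (Y, j) \<in> type_index T}"

lemma subspace_comp: "subspace (comp M j)"
  and comp_outside: "j \<notin> {1..n-1} \<Longrightarrow> comp M j = {0}"
  and comp_indep: "\<lbrakk>\<And>j. j \<in> {1..n-1} \<Longrightarrow> v j \<in> comp M j; (\<Sum>j\<in>{1..n-1}. v j) = 0; j \<in> {1..n-1}\<rbrakk>
    \<Longrightarrow> v j = 0"
  and linear_on_up: "j \<in> {1..n-1} \<Longrightarrow> linear_on s s (comp M j) (up M j)"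
  and linear_on_down: "j \<in> {1..n-1} \<Longrightarrow> linear_on s s (comp M j) (down M j)"
  and up_in: "j \<in> {1..n-1} \<Longrightarrow> v' \<in> comp M j \<Longrightarrow> up M j v' \<in> comp M (j + 1)"
  and down_in: "j \<in> {1..n-1} \<Longrightarrow> v' \<in> comp M j \<Longrightarrow> down M j v' \<in> comp M (j - 1)"
  and relation: "j \<in> {1..n-1} \<Longrightarrow> v' \<in> comp M j \<Longrightarrow>
    (if j + 1 \<le> n - 1 then down M (j + 1) (up M j v') else 0) =
    (if 1 \<le> j - 1 then up M (j - 1) (down M j v') else 0)"
  using Lambda unfolding Lambda_module_def image_subset_iff by meson+

lemma type_index_degree: "(X, j) \<in> type_index T \<Longrightarrow> j \<in> {1..n-1}"
  using entry_le[of X] by (auto simp: type_index_def boxes_def box_row_def)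

lemma comp_subset_total: "comp M j \<subseteq> total_space s n M"
proof (cases "j \<in> {1..n-1}")
  case True
  then show ?thesis unfolding total_space_def by (blast intro: span_base)
qed (simp add: comp_outside total_space_def span_zero)

lemma span_w_deg_subset: "span (w_deg j) \<subseteq> comp M j"
  by (intro span_minimal subspace_comp) (auto intro: w_comp)

text \<open>Groups a basis expansion by degree: each new term of the span induction is added to the
  summand of its own degree.\<close>

lemma total_space_decompose:
  assumes "x \<in> total_space s n M"
  obtains y where "\<And>j. y j \<in> span (w_deg j)" "x = (\<Sum>j\<in>{1..n-1}. y j)"
proof -
  have "x \<in> span ((\<lambda>(X, j). w X j) ` type_index T)" using assms w_span by simp
  then have "\<exists>y. (\<forall>j. y j \<in> span (w_deg j)) \<and> x = (\<Sum>j\<in>{1..n-1}. y j)"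
  proof (induction rule: span_induct_alt)
    case base
    show ?case by (intro exI[of _ "\<lambda>_. 0"]) (auto simp: span_zero)
  next
    case (step c b x)
    then obtain X j y where b: "(X, j) \<in> type_index T" "b = w X j"
      and y: "\<forall>j. y j \<in> span (w_deg j)" "x = (\<Sum>j\<in>{1..n-1}. y j)" by auto
    have "s c b \<in> span (w_deg j)" using b by (intro span_scale span_base) blast
    then have "\<forall>l. (if l = j then s c b else 0) + y l \<in> span (w_deg l)"
      using y(1) by (auto intro: span_add)
    moreover have "s c b + x = (\<Sum>l\<in>{1..n-1}. (if l = j then s c b else 0) + y l)"
      using type_index_degree[OF b(1)] y(2) by (simp add: sum.distrib)
    ultimately show ?case by (intro exI[of _ "\<lambda>l. (if l = j then s c b else 0) + y l"]) blast
  qed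
  then show thesis using that by blast
qed

text \<open>The basis is only known to span the total space. Directness of the grading localises
  this: comparing \<open>v\<close> in degree \<open>j\<close> with its decomposition into
  homogeneous summands identifies \<open>v\<close> with the summand \<open>y j\<close>.\<close>

lemma comp_eq_span: "comp M j = span (w_deg j)"
proof (cases "j \<in> {1..n-1}")
  case False
  then show ?thesis using comp_outside[OF False] span_w_deg_subset[of j] span_zero[of "w_deg j"] by auto
next
  case True
  have "v \<in> span (w_deg j)" if v: "v \<in> comp M j" for v
  proof -
    obtain y where y: "\<And>j. y j \<in> span (w_deg j)" "v = (\<Sum>j\<in>{1..n-1}. y j)"
      using total_space_decompose v comp_subset_total by blast
    \<comment> \<open>The trivial test \<open>j = j\<close> is kept because this is the value at
      \<open>j\<close> of the family to which \<open>comp_indep\<close> is applied.\<close>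
    have "y j - (if j = j then v else 0) = 0"
    proof (rule comp_indep[where v = "\<lambda>l. y l - (if l = j then v else 0)"])
      show "y l - (if l = j then v else 0) \<in> comp M l" for l
        using y(1)[of l] span_w_deg_subset[of l] v subspace_comp[of l]
        by (auto intro!: subspace_diff)
      show "(\<Sum>l\<in>{1..n-1}. y l - (if l = j then v else 0)) = 0"
        using True y(2) by (simp add: sum_subtractf)
    qed fact
    then show ?thesis using y(1)[of j] by simp
  qed
  then show ?thesis using span_w_deg_subset[of j] by blast
qed

lemma linear_zero_on_comp:
  assumes "Vector_Spaces.linear s s' L" and "\<And>Y. (Y, j) \<in> type_index T \<Longrightarrow> L (w Y j) = 0"
    and "v \<in> comp M j"
  shows "L v = 0"
proof -
  interpret Vector_Spaces.linear s s' L by fact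
  show ?thesis
    using assms(3) unfolding comp_eq_span
    by (induction rule: span_induct_alt) (auto simp: zero add scale assms(2))
qed

lemma linear_on_zero_on_total:
  assumes "vector_space s'" and f: "linear_on s s' (total_space s n M) f"
    and zero: "\<And>j v. j \<in> {1..n-1} \<Longrightarrow> v \<in> comp M j \<Longrightarrow> f v = 0" and x: "x \<in> total_space s n M"
  shows "f x = 0"
proof -
  interpret W: vector_space s' by fact
  show ?thesis
  proof (rule linear_on_eq_on_span[of s s' "(\<lambda>(X, j). w X j) ` type_index T" f "\<lambda>_. 0"])
    show "linear_on s s' (span ((\<lambda>(X, j). w X j) ` type_index T)) f"
      using f by (simp add: w_span)
    show "x \<in> span ((\<lambda>(X, j). w X j) ` type_index T)" using x by (simp add: w_span)
    show "f b = 0" if "b \<in> (\<lambda>(X, j). w X j) ` type_index T" for b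
    proof -
      from that obtain X j where "(X, j) \<in> type_index T" "b = w X j" by (auto simp del: split_paired_Ex)
      then show ?thesis using zero w_comp type_index_degree by blast
    qed
  qed (auto simp: linear_on_def vector_space_axioms W.vector_space_axioms)
qed

text \<open>The structure maps depend on the degree and have arbitrary values off their component.
  Gluing them into one globally linear map, prescribed on the basis, makes it possible to iterate
  them with \<open>^^\<close> and to use linearity without side conditions.\<close>

lemma extend_to_linear:
  assumes g: "\<And>j. j \<in> {1..n-1} \<Longrightarrow> linear_on s s (comp M j) (g j)"
  obtains L where "Vector_Spaces.linear s s L"
    "\<And>j v. j \<in> {1..n-1} \<Longrightarrow> v \<in> comp M j \<Longrightarrow> L v = g j v"
proof -
  obtain L where L: "Vector_Spaces.linear s s L"
    and Lw: "\<And>p. p \<in> type_index T \<Longrightarrow> L (case p of (X, j) \<Rightarrow> w X j) = (case p of (X, j) \<Rightarrow> g j (w X j))"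
    by (rule exists_linear_on_basis[OF vector_space_axioms vector_space_axioms w_inj w_indep,
          where h = "\<lambda>(X, j). g j (w X j)"]) (rule that)
  show thesis
  proof (rule that[OF L])
    fix j v assume j: "j \<in> {1..n-1}" and v: "v \<in> comp M j"
    show "L v = g j v"
      by (rule linear_on_eq_on_span[OF vector_space_axioms vector_space_axioms, of "w_deg j" L "g j"])
        (use g[OF j] v Lw[of "(_, j)"] in \<open>auto simp: comp_eq_span[symmetric] simp del: split_paired_Ex intro: linear_imp_linear_on L\<close>)
  qed
qed

section \<open>Construction of homomorphisms into the injective Maya module\<close>

text \<open>The functional chosen is the coordinate at the basis vector \<open>w X i\<close>. The
  bound c(X) <= t is what makes it vanish on everything generated in degrees at least t, so that it
  comes from a homomorphism.\<close>

lemma exists_hom_dual_to_box: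
  fixes i t :: nat
  defines "A \<equiv> {t - i + 1..t}"
  assumes it: "1 \<le> i" "i < t"
    and X: "X \<in> boxes T" "box_row X \<le> i" "i < box_entry T X" "box_entry T X \<le> t"
  obtains f where "f \<in> Lambda_Hom s maya_scale n M (maya_module A :: (nat \<times> nat \<Rightarrow> 'k) graded_rep)"
    "\<And>Y. (Y, i) \<in> type_index T \<Longrightarrow> f (w Y i) (i, i) = (if X = Y then 1 else 0)"
proof -
  let ?N = "maya_module A :: (nat \<times> nat \<Rightarrow> 'k) graded_rep"
  have A: "(j, k) \<in> maya_index A \<longleftrightarrow> 1 \<le> k \<and> k \<le> i \<and> k \<le> j \<and> j + i < t + k" for j k
    unfolding A_def by (rule maya_index_interval) fact
  obtain U where U: "Vector_Spaces.linear s s U"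
    and U_eq: "\<And>j v. j \<in> {1..n-1} \<Longrightarrow> v \<in> comp M j \<Longrightarrow> U v = up M j v"
    using extend_to_linear[OF linear_on_up] by blast
  obtain D where D: "Vector_Spaces.linear s s D"
    and D_eq: "\<And>j v. j \<in> {1..n-1} \<Longrightarrow> v \<in> comp M j \<Longrightarrow> D v = down M j v"
    using extend_to_linear[OF linear_on_down] by blast
  obtain \<phi> where \<phi>: "Vector_Spaces.linear s (*) \<phi>"
    and \<phi>_w': "\<And>p. p \<in> type_index T \<Longrightarrow> \<phi> (case p of (X, j) \<Rightarrow> w X j) = (if p = (X, i) then 1 else 0)"
    by (rule exists_linear_on_basis[OF vector_space_axioms vector_space_times w_inj w_indep,
          where h = "\<lambda>p. if p = (X, i) then 1 else 0"]) (rule that)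
  interpret U: Vector_Spaces.linear s s U by (rule U)
  interpret D: Vector_Spaces.linear s s D by (rule D)
  interpret \<phi>: Vector_Spaces.linear s "(*)" \<phi> by (rule \<phi>)
  have \<phi>_w: "\<phi> (w Y j) = 0" if "(Y, j) \<noteq> (X, i)" for Y j
    using \<phi>_w'[of "(Y, j)"] that w_zero[of Y j] by (cases "(Y, j) \<in> type_index T") (auto simp: \<phi>.zero)

  have U_in: "U v \<in> comp M (j + 1)" and D_in: "D v \<in> comp M (j - 1)" and DU: "D (U v) = U (D v)"
    if v: "v \<in> comp M j" for v j
  proof -
    have "U v \<in> comp M (j + 1) \<and> D v \<in> comp M (j - 1) \<and> D (U v) = U (D v)"
    proof (cases "j \<in> {1..n-1}")
      case False
      then have "v = 0" using v comp_outside by auto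
      then show ?thesis by (simp add: U.zero D.zero subspace_0 subspace_comp)
    next
      case True
      have Uv: "U v \<in> comp M (j + 1)" and Dv: "D v \<in> comp M (j - 1)"
        using True v U_eq D_eq up_in down_in by auto
      \<comment> \<open>The conditionals of the preprojective relation disappear for
        \<open>U\<close> and \<open>D\<close>: a path through degree 0 or n passes through a zero
        component, and linear maps send 0 to 0.\<close>
      have "D (U v) = (if j + 1 \<le> n - 1 then down M (j + 1) (up M j v) else 0)"
        using D_eq[OF _ Uv] Uv comp_outside[of "j + 1"] unfolding U_eq[OF True v, symmetric]
        by (cases "j + 1 \<le> n - 1") (simp_all add: D.zero)
      also have "\<dots> = (if 1 \<le> j - 1 then up M (j - 1) (down M j v) else 0)"
        by (rule relation) fact+
      also have "\<dots> = U (D v)"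
        using True U_eq[OF _ Dv] Dv comp_outside[of "j - 1"] unfolding D_eq[OF True v, symmetric]
        by (cases "1 \<le> j - 1") (auto simp: U.zero)
      finally show ?thesis using Uv Dv by simp
    qed
    then show "U v \<in> comp M (j + 1)" "D v \<in> comp M (j - 1)" "D (U v) = U (D v)" by auto
  qed
  have U_pow: "(U ^^ b) v \<in> comp M (j + b)" if "v \<in> comp M j" for v j b
    by (induction b) (use that U_in in auto)
  \<comment> \<open>Truncated subtraction is harmless here: a degree that would become negative is
    recorded as 0, and \<open>comp M 0\<close> is zero.\<close>
  have D_pow: "(D ^^ a) v \<in> comp M (j - a)" if "v \<in> comp M j" for v j a
  proof (induction a)
    case (Suc a)
    then show ?case using D_in[OF Suc] by simp
  qed (use that in simp)
  have UD_pow: "(U ^^ b) (D v) = D ((U ^^ b) v)" if "v \<in> comp M j" for v j b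
    by (induction b) (simp_all add: DU[OF U_pow[OF that]])
  have DU_pow: "(D ^^ a) ((U ^^ b) v) = (U ^^ b) ((D ^^ a) v)" if v: "v \<in> comp M j" for v j a b
  proof (induction a)
    case (Suc a)
    then show ?case using UD_pow[OF D_pow[OF v]] by simp
  qed simp
  have linear_U: "Vector_Spaces.linear s s (U ^^ b)" and linear_D: "Vector_Spaces.linear s s (D ^^ b)" for b
    by (induction b) (auto simp: id_def[symmetric] linear_id intro: Vector_Spaces.linear_compose U D)
  have D_w: "(D ^^ a) (w Y j) = w Y (j - a)" if Yj: "(Y, j) \<in> type_index T" for Y j a
  proof (induction a)
    case (Suc a)
    show ?case
    proof (cases "(Y, j - a) \<in> type_index T")
      case True
      then show ?thesis
        using Suc D_eq[OF type_index_degree[OF True] w_comp[OF True]] down_w[OF True] by simp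
    next
      case False
      then have "(Y, j - Suc a) \<notin> type_index T" using Yj by (auto simp: type_index_def)
      then show ?thesis using Suc False by (simp add: w_zero D.zero)
    qed
  qed simp

  have \<phi>_degree: "\<phi> v = 0" if "v \<in> comp M j" "j \<noteq> i" for v j
    by (rule linear_zero_on_comp[OF \<phi> _ that(1)]) (use that(2) in \<open>auto intro: \<phi>_w\<close>)
  \<comment> \<open>\<open>\<phi>\<close> kills the submodule generated by the components of degree at least \<open>t\<close>.\<close>
  have \<phi>_high: "\<phi> ((D ^^ a) v) = 0" if v: "v \<in> comp M j" and j: "t \<le> j" for v j a
  proof -
    have "(\<phi> \<circ> D ^^ a) v = 0"
    proof (rule linear_zero_on_comp[OF Vector_Spaces.linear_compose[OF linear_D \<phi>] _ v])
      fix Y assume Y: "(Y, j) \<in> type_index T"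
      \<comment> \<open>A vector of box Y in degree j >= t forces c(Y) > t >= c(X). Lowering it
        stays within the box Y, so the coordinate at X never appears.\<close>
      then have "Y \<noteq> X" using X j it by (auto simp: type_index_def)
      then show "(\<phi> \<circ> D ^^ a) (w Y j) = 0" using D_w[OF Y] by (simp add: \<phi>_w)
    qed
    then show ?thesis by simp
  qed

  \<comment> \<open>In N(A), raising w_{j,k} by i-k steps and then lowering it by j-k steps ends in
    the socle vector w_{i,i}; the same path in M is followed by \<open>\<phi>\<close>. Testing
    membership in the total space gives the normalisation required by
    \<open>Lambda_Hom\<close>.\<close>
  define f where "f x = (\<lambda>(j, k). if (j, k) \<in> maya_index A \<and> x \<in> total_space s n M
      then \<phi> ((D ^^ (j - k)) ((U ^^ (i - k)) x)) else 0)" for x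
  have total: "v \<in> total_space s n M" if "v \<in> comp M j" for v j
    using that comp_subset_total by auto
  have f_comp: "f v \<in> comp ?N j" if v: "v \<in> comp M j" for v j
    unfolding maya_comp_iff
  proof (intro allI impI, rule ccontr)
    fix p assume p: "f v p \<noteq> 0" "\<not> (p \<in> maya_index A \<and> fst p = j)"
    then obtain a b where ab: "p = (a, b)" "(a, b) \<in> maya_index A" "a \<noteq> j"
      by (cases p) (auto simp: f_def split: if_splits)
    have "(D ^^ (a - b)) ((U ^^ (i - b)) v) \<in> comp M (j + (i - b) - (a - b))"
      by (intro D_pow U_pow v)
    \<comment> \<open>Without truncation the degree is i + j - a, which differs from i as
      \<open>a\<close> is not \<open>j\<close>; with truncation it is 0, while i >= 1.\<close>
    moreover have "j + (i - b) - (a - b) \<noteq> i" using ab it by (auto simp: A)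
    ultimately have "\<phi> ((D ^^ (a - b)) ((U ^^ (i - b)) v)) = 0" by (rule \<phi>_degree)
    then show False using p(1) ab by (simp add: f_def split: if_splits)
  qed
  have f_down: "f (down M j v) = down ?N j (f v)" if j: "j \<in> {1..n-1}" and v: "v \<in> comp M j" for v j
  proof
    fix p :: "nat \<times> nat"
    obtain a b where p: "p = (a, b)" by (cases p)
    have Dv: "down M j v = D v" "D v \<in> comp M (j - 1)" using D_eq[OF j v] D_in[OF v] by auto
    show "f (down M j v) p = down ?N j (f v) p"
    proof (cases "a = j - 1 \<and> (a, b) \<in> maya_index A")
      case False
      then show ?thesis
        using f_comp[OF Dv(2)] unfolding maya_comp_iff by (auto simp: p maya_down_apply Dv(1))
    next
      case True
      then have "j - b = Suc (a - b)" using j by (auto simp: A)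
      then have "(D ^^ (a - b)) (D x) = (D ^^ (j - b)) x" for x by (simp add: funpow_swap1)
      then have eq: "f (down M j v) p = \<phi> ((D ^^ (j - b)) ((U ^^ (i - b)) v))"
        using True Dv total UD_pow[OF v] by (auto simp: f_def p)
      show ?thesis
      proof (cases "(j, b) \<in> maya_index A")
        case True
        then show ?thesis using \<open>a = j - 1 \<and> _\<close> total[OF v]
          unfolding eq by (auto simp: p maya_down_apply f_def)
      next
        case False
        \<comment> \<open>The index (j-1, b) is allowed but (j, b) is not, so j + i = t + b. Hence
          the raised vector lies in degree t, where \<open>\<phi>_high\<close> applies.\<close>
        then have "t \<le> j + (i - b)" using True by (auto simp: A)
        then have "f (down M j v) p = 0" using eq \<phi>_high[OF U_pow[OF v]] by simp
        then show ?thesis using False by (simp add: p maya_down_apply)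
      qed
    qed
  qed
  have f_up: "f (up M j v) = up ?N j (f v)" if j: "j \<in> {1..n-1}" and v: "v \<in> comp M j" for v j
  proof
    fix p :: "nat \<times> nat"
    obtain a b where p: "p = (a, b)" by (cases p)
    have Uv: "up M j v = U v" "U v \<in> comp M (j + 1)" using U_eq[OF j v] U_in[OF v] by auto
    show "f (up M j v) p = up ?N j (f v) p"
    proof (cases "a = j + 1 \<and> (a, b) \<in> maya_index A")
      case False
      then show ?thesis
        using f_comp[OF Uv(2)] unfolding maya_comp_iff by (auto simp: p maya_up_apply Uv(1))
    next
      case True
      then have eq: "f (up M j v) p = \<phi> ((D ^^ (j + 1 - b)) ((U ^^ (i - b + 1)) v))"
        using Uv total by (auto simp: f_def p funpow_swap1)
      show ?thesis
      proof (cases "2 \<le> b")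
        case True
        then have "(j, b - 1) \<in> maya_index A" "j + 1 - b = j - (b - 1)" "i - b + 1 = i - (b - 1)"
          using \<open>a = j + 1 \<and> _\<close> by (auto simp: A)
        then show ?thesis
          using \<open>a = j + 1 \<and> _\<close> total[OF v] unfolding eq by (auto simp: p maya_up_apply f_def)
      next
        case False
        then have b: "b = 1" using \<open>a = j + 1 \<and> _\<close> by (auto simp: A)
        \<comment> \<open>No basis vector of N(A) is mapped upwards to row index 1, so this
          coordinate has to vanish. Commuting the lowering maps to the front pushes \<open>v\<close>
          into degree 0 before it is raised.\<close>
        have "(D ^^ j) v = 0" using D_pow[OF v, of j] comp_outside[of 0] by simp
        moreover have "(U ^^ i) 0 = 0"
          by (rule module_hom.zero) (rule linear_U[unfolded Vector_Spaces.linear_iff_module_hom])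
        ultimately have "f (up M j v) p = 0"
          using eq b it DU_pow[OF v, of j i] by (simp add: \<phi>.zero)
        then show ?thesis using b by (auto simp: p maya_up_apply A)
      qed
    qed
  qed
  have lin: "linear_on s maya_scale (total_space s n M) f"
  proof -
    have "\<phi> ((D ^^ a) ((U ^^ b) (x + y))) = \<phi> ((D ^^ a) ((U ^^ b) x)) + \<phi> ((D ^^ a) ((U ^^ b) y))"
      "\<phi> ((D ^^ a) ((U ^^ b) (s c x))) = c * \<phi> ((D ^^ a) ((U ^^ b) x))" for a b x y c
    proof -
      interpret Ub: Vector_Spaces.linear s s "U ^^ b" by (rule linear_U)
      interpret Da: Vector_Spaces.linear s s "D ^^ a" by (rule linear_D)
      show "\<phi> ((D ^^ a) ((U ^^ b) (x + y))) = \<phi> ((D ^^ a) ((U ^^ b) x)) + \<phi> ((D ^^ a) ((U ^^ b) y))"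
        "\<phi> ((D ^^ a) ((U ^^ b) (s c x))) = c * \<phi> ((D ^^ a) ((U ^^ b) x))"
        by (simp_all add: Ub.add Da.add \<phi>.add Ub.scale Da.scale \<phi>.scale)
    qed
    then show ?thesis
      by (auto simp: linear_on_def f_def fun_eq_iff fun_scale_def total_space_def span_add span_scale)
  qed
  show thesis
  proof (rule that)
    show "f \<in> Lambda_Hom s maya_scale n M ?N"
      unfolding Lambda_Hom_def using lin f_comp f_up f_down by (auto simp: f_def[of "x" for x] fun_eq_iff)
    show "f (w Y i) (i, i) = (if X = Y then 1 else 0)" if Y: "(Y, i) \<in> type_index T" for Y
      using \<phi>_w'[OF Y] it total[OF w_comp[OF Y]] by (auto simp: f_def A)
  qed
qed

section \<open>Homomorphisms are determined by their socle coordinate on the counted boxes\<close>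

text \<open>Basis vectors in degree i from boxes with c(X) > t are killed by any homomorphism, so
  the hypothesis makes the socle coordinate vanish on all of degree i. Compatibility with the
  downward maps spreads this to the coordinates (j, i), and compatibility with the upward maps to
  those with smaller k.\<close>

lemma hom_eq_zero:
  fixes i t :: nat
  defines "A \<equiv> {t - i + 1..t}"
  assumes it: "1 \<le> i" "i < t" "t \<le> n"
    and f: "f \<in> Lambda_Hom s maya_scale n M (maya_module A :: (nat \<times> nat \<Rightarrow> 'k) graded_rep)"
    and zero: "\<And>X. X \<in> boxes T \<Longrightarrow> box_row X \<le> i \<Longrightarrow> i < box_entry T X \<Longrightarrow> box_entry T X \<le> t
      \<Longrightarrow> f (w X i) (i, i) = 0"
  shows "f = 0"
proof -
  let ?N = "maya_module A :: (nat \<times> nat \<Rightarrow> 'k) graded_rep"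
  have A: "(j, k) \<in> maya_index A \<longleftrightarrow> 1 \<le> k \<and> k \<le> i \<and> k \<le> j \<and> j + i < t + k" for j k
    unfolding A_def by (rule maya_index_interval) fact
  have lin: "linear_on s maya_scale (total_space s n M) f"
    and outside: "\<And>x. x \<notin> total_space s n M \<Longrightarrow> f x = 0"
    and comp: "\<And>j v. j \<in> {1..n-1} \<Longrightarrow> v \<in> comp M j \<Longrightarrow> f v \<in> comp ?N j"
    and up: "\<And>j v. j \<in> {1..n-1} \<Longrightarrow> v \<in> comp M j \<Longrightarrow> f (up M j v) = up ?N j (f v)"
    and down: "\<And>j v. j \<in> {1..n-1} \<Longrightarrow> v \<in> comp M j \<Longrightarrow> f (down M j v) = down ?N j (f v)"
    using f by (auto simp: Lambda_Hom_def image_subset_iff)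
  have high: "f (w X j) = 0" if X: "X \<in> boxes T" "t < box_entry T X" for X j
  proof (cases "(X, j) \<in> type_index T")
    case False
    have "f 0 = 0"
      using lin unfolding total_space_def
      by (rule linear_on_zero[OF vector_space_axioms vector_space_fun_scale[OF vector_space_times]])
    then show ?thesis using False by (simp add: w_zero)
  next
    case True
    then have "j \<le> box_entry T X - 1" by (simp add: type_index_def)
    then show ?thesis
    proof (induction rule: inc_induct)
      case base
      have "(X, box_entry T X - 1) \<in> type_index T" using True by (auto simp: type_index_def)
      \<comment> \<open>The top vector of the box has degree c(X)-1 >= t, whereas N(A) lives in
        degrees below t. The induction then descends, each vector being the image of the next higher
        one under the downward map.\<close>
      from comp[OF type_index_degree[OF this] w_comp[OF this]] show ?case
        using X(2) it by (intro ext ccontr[of "_ = _"]) (force simp: maya_comp_iff A)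
    next
      case (step l)
      have "(X, Suc l) \<in> type_index T" using True step.hyps by (auto simp: type_index_def)
      from down[OF type_index_degree[OF this] w_comp[OF this]] down_w[OF this] step.IH show ?case
        by (auto simp: fun_eq_iff maya_down_apply)
    qed
  qed
  have socle: "f v (i, i) = 0" if v: "v \<in> comp M i" for v
  proof -
    have i: "i \<in> {1..n-1}" using it by auto
    have "(\<lambda>x. f x (i, i)) v = 0"
    proof (rule linear_on_eq_on_span[OF vector_space_axioms vector_space_times, of "w_deg i" _ "\<lambda>_. 0"])
      show "linear_on s (*) (span (w_deg i)) (\<lambda>x. f x (i, i))"
        using lin comp_subset_total[of i] unfolding linear_on_def comp_eq_span
        by (auto simp: fun_scale_def subset_iff)
      show "f x (i, i) = 0" if "x \<in> w_deg i" for x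
      proof -
        from that obtain X where X: "(X, i) \<in> type_index T" "x = w X i" by blast
        then have "X \<in> boxes T" "box_row X \<le> i" "i < box_entry T X"
          using it(1) by (auto simp: type_index_def)
        then show ?thesis using zero[of X] high[of X i] X(2) by (cases "box_entry T X \<le> t") auto
      qed
      show "v \<in> span (w_deg i)" using v by (simp add: comp_eq_span)
    qed (simp add: linear_on_def)
    then show ?thesis by simp
  qed
  \<comment> \<open>Coordinate (j+1, i) of \<open>f v\<close> is coordinate (j, i) of the image of
    the lowered vector, so the induction starts from the socle.\<close>
  have last: "f v (j, i) = 0" if "i \<le> j" "j < t" "v \<in> comp M j" for j v
    using that
  proof (induction j arbitrary: v rule: dec_induct)
    case base
    then show ?case by (simp add: socle)
  next
    case (step j)
    have j: "Suc j \<in> {1..n-1}" using step it by auto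
    have "down M (Suc j) v \<in> comp M j" using down_in[OF j] step by simp
    then have "f (down M (Suc j) v) (j, i) = 0" using step by simp
    then show ?case using down[OF j] step it by (simp add: maya_down_apply A)
  qed
  have coord: "f v (j, k) = 0" if "(j, k) \<in> maya_index A" "v \<in> comp M j" for j k v
  proof -
    have "k \<le> i" using that by (simp add: A)
    then show ?thesis using that
    \<comment> \<open>Descending induction on k from k = i: coordinate (j, k) of \<open>f v\<close>
      equals coordinate (j+1, k+1) of the image of the raised vector.\<close>
    proof (induction arbitrary: j v rule: inc_induct)
      case base
      then show ?case using last by (simp add: A)
    next
      case (step k)
      have j: "j \<in> {1..n-1}" using step it by (auto simp: A)
      have "(j + 1, Suc k) \<in> maya_index A" using step by (auto simp: A)
      moreover from this have "f (up M j v) (j + 1, Suc k) = 0"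
        using step up_in[OF j] by blast
      ultimately show ?case using up[OF j] step by (simp add: maya_up_apply)
    qed
  qed
  have "f v = 0" if "j \<in> {1..n-1}" "v \<in> comp M j" for j v
    using comp[OF that] coord[OF _ that(2)] by (intro ext) (auto simp: maya_comp_iff)
  then have "f x = 0" for x
    using linear_on_zero_on_total[OF vector_space_fun_scale[OF vector_space_times] lin] outside by blast
  then show ?thesis by (simp add: fun_eq_iff)
qed

end

section \<open>The dimension count\<close>

theorem theorem4p2:
  fixes n i t :: nat
    and T :: "nat list list"
    and s :: "'k::field \<Rightarrow> 'v::ab_group_add \<Rightarrow> 'v"
    and M :: "'v graded_rep"
    and A :: "nat set"
  assumes "n \<ge> 2"
    and "semistandard T"
    and "\<forall>X\<in>boxes T. box_entry T X \<in> {1..n}"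
    and "length T \<le> n - 1"
    and "Lambda_module s n M"
    and "of_type s n T M"
    and "1 \<le> i" and "i < t" and "t \<le> n"
    and "A = {t - i + 1..t}"
  shows "vector_space.dim (fun_scale maya_scale)
           (Lambda_Hom s maya_scale n M (maya_module A :: (nat \<times> nat \<Rightarrow> 'k) graded_rep))
         = card {X \<in> boxes T. box_row X \<le> i \<and> i < box_entry T X \<and> box_entry T X \<le> t}"
    (is "_ = card ?S")
proof -
  have vs: "vector_space s" using assms(5) by (simp add: Lambda_module_def)
  have "\<exists>w. tableau_module s n T M w"
    using assms(6) unfolding of_type_def
    by (elim exE conjE, rule_tac x = w in exI,
        intro tableau_module.intro tableau_module_axioms.intro) (use assms(3,5) vs in auto)
  then obtain w where "tableau_module s n T M w" ..
  then interpret tableau_module s n T M w .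
  let ?V = "Lambda_Hom s maya_scale n M (maya_module A :: (nat \<times> nat \<Rightarrow> 'k) graded_rep)"
  have index: "(X, i) \<in> type_index T" if "X \<in> ?S" for X
    using that by (auto simp: type_index_def)
  have "\<forall>X\<in>?S. \<exists>f. f \<in> ?V \<and>
      (\<forall>Y. (Y, i) \<in> type_index T \<longrightarrow> f (w Y i) (i, i) = (if X = Y then 1 else 0))"
  proof
    fix X assume "X \<in> ?S"
    then show "\<exists>f. f \<in> ?V \<and>
        (\<forall>Y. (Y, i) \<in> type_index T \<longrightarrow> f (w Y i) (i, i) = (if X = Y then 1 else 0))"
      using exists_hom_dual_to_box[OF assms(7,8), of X] unfolding assms(10) by blast
  qed
  then obtain F where F: "\<And>X. X \<in> ?S \<Longrightarrow> F X \<in> ?V"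
    "\<And>X Y. X \<in> ?S \<Longrightarrow> (Y, i) \<in> type_index T \<Longrightarrow> F X (w Y i) (i, i) = (if X = Y then 1 else 0)"
    by (metis (no_types, lifting))
  show ?thesis
  \<comment> \<open>The dual functionals read off the socle coordinate of the image of
    \<open>w X i\<close>, one for each counted box.\<close>
  proof (rule dim_eq_card_dual_family[where F = F and ev = "\<lambda>X f. f (w X i) (i, i)"])
    show hom_vs: "vector_space (fun_scale maya_scale :: 'k \<Rightarrow> ('v \<Rightarrow> nat \<times> nat \<Rightarrow> 'k) \<Rightarrow> _)"
      by (intro vector_space_fun_scale vector_space_times)
    show "module.subspace (fun_scale maya_scale) ?V" by (rule subspace_Hom_maya[OF vs])
    show "Vector_Spaces.linear (fun_scale maya_scale) (*) (\<lambda>f. f (w X i) (i, i) :: 'k)" for X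
      using hom_vs vector_space_times by (auto simp: Vector_Spaces.linear_iff fun_scale_def)
    show "F Y (w X i) (i, i) = (if X = Y then 1 else 0)" if "X \<in> ?S" "Y \<in> ?S" for X Y
      using F(2)[OF that(2) index[OF that(1)]] by auto
    show "f = 0" if "f \<in> ?V" "\<And>X. X \<in> ?S \<Longrightarrow> f (w X i) (i, i) = 0" for f
      by (rule hom_eq_zero[OF assms(7-9)]) (use that assms(10) in auto)
  qed (use F(1) in auto)
qed

end
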